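(* For any graph $G$, $\mathrm{Ind}(M_2(G)) \simeq \Sigma(\mathrm{Ind}(G))$, where $M_2(G)$ is the Mycielskian of $G$ and $\Sigma$ denotes suspension.
   Context: All graphs are finite. For $r\ge 1$, $L_r$ is the graph with vertex set $\{0,1,\dots,r\}$ and edges $\{i,i+1\}$ for $0\le i\le r-1$ together with a loop at $0$. The categorical product $G\times H$ has vertex set $V(G)\times V(H)$, with $(g,h)\sim(g',h')$ iff $g\sim g'$ in $G$ and $h\sim h'$ in $H$. The $r$-th generalised Mycielskian $M_r(G)$ is the graph $(G\times L_r)/\sim_r$ obtained by identifying all vertices whose second coordinate is $r$ into a single vertex (adjacencies inherited); $M_2(G)$ is the Mycielskian of $G$. The independence complex $\mathrm{Ind}(G)$ is the simplicial complex whose simplices are the independent sets of vertices of $G$ (sets containing no two adjacent vertices). Complexes are identified with their geometric realizations; $\simeq$ is homotopy equivalence. *)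

theory Defs
  imports "HOL-Analysis.Analysis" "Graph_Theory.Pair_Digraph"
begin

section \<open>Graphs\<close>

text \<open>
  Finite undirected graphs without multiple edges, loops being permitted, are the
  pair digraphs satisfying the locale predicate \<^const>\<open>pair_pseudo_graph\<close>: an edge
  $\{u,v\}$ is the pair of arcs $(u,v)$, $(v,u)$.
\<close>

definition looped_path :: "nat \<Rightarrow> nat pair_pre_digraph" where
  "looped_path r = \<lparr> pverts = {0..r},
     parcs = insert (0, 0) ({(i, Suc i) |i. i < r} \<union> {(Suc i, i) |i. i < r}) \<rparr>"

definition categorical_product ::
  "'a pair_pre_digraph \<Rightarrow> 'b pair_pre_digraph \<Rightarrow> ('a \<times> 'b) pair_pre_digraph" where
  "categorical_product G H = \<lparr> pverts = pverts G \<times> pverts H,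
     parcs = {((g, h), (g', h')) |g h g' h'. (g, g') \<in> parcs G \<and> (h, h') \<in> parcs H} \<rparr>"

text \<open>
  Identification of vertices along an equivalence relation on the vertex set: the new
  vertices are the equivalence classes, and two classes are adjacent iff some
  representatives are.
\<close>

definition quotient_graph :: "'a pair_pre_digraph \<Rightarrow> 'a rel \<Rightarrow> 'a set pair_pre_digraph" where
  "quotient_graph G R = \<lparr> pverts = pverts G // R,
     parcs = {(R `` {u}, R `` {v}) |u v. (u, v) \<in> parcs G} \<rparr>"

definition top_level_rel :: "'a pair_pre_digraph \<Rightarrow> nat \<Rightarrow> ('a \<times> nat) rel" where
  "top_level_rel G r = {(p, q). p \<in> pverts G \<times> {0..r} \<and> q \<in> pverts G \<times> {0..r} \<and>
     (p = q \<or> snd p = r \<and> snd q = r)}"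

definition generalised_mycielskian ::
  "nat \<Rightarrow> 'a pair_pre_digraph \<Rightarrow> ('a \<times> nat) set pair_pre_digraph" where
  "generalised_mycielskian r G =
     quotient_graph (categorical_product G (looped_path r)) (top_level_rel G r)"

abbreviation mycielskian :: "'a pair_pre_digraph \<Rightarrow> ('a \<times> nat) set pair_pre_digraph" where
  "mycielskian \<equiv> generalised_mycielskian 2"

lemma pair_pseudo_graphI:
  assumes "finite (pverts G)" "parcs G \<subseteq> pverts G \<times> pverts G" "sym (parcs G)"
  shows "pair_pseudo_graph G"
proof -
  have "finite (parcs G)"
    using assms(1,2) by (meson finite_SigmaI finite_subset)
  moreover have "symmetric (with_proj G)"
    using assms(3) by (simp add: symmetric_def)
  ultimately show ?thesis
    using assms(1,2) by unfold_locales auto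
qed

lemma pair_pseudo_graphD:
  assumes "pair_pseudo_graph G"
  shows "finite (pverts G)" "parcs G \<subseteq> pverts G \<times> pverts G" "sym (parcs G)"
proof -
  interpret pair_pseudo_graph G by fact
  show "finite (pverts G)" by (rule pair_finite_verts)
  show "parcs G \<subseteq> pverts G \<times> pverts G"
    using arc_fst_in_verts arc_snd_in_verts by fastforce
  show "sym (parcs G)"
    using pair_sym_arcs by (simp add: symmetric_def)
qed

lemma pair_pseudo_graph_looped_path: "pair_pseudo_graph (looped_path r)"
  by (rule pair_pseudo_graphI) (auto simp: looped_path_def sym_def)

lemma pair_pseudo_graph_categorical_product:
  assumes "pair_pseudo_graph G" "pair_pseudo_graph H"
  shows "pair_pseudo_graph (categorical_product G H)"
  using pair_pseudo_graphD[OF assms(1)] pair_pseudo_graphD[OF assms(2)]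
  by (intro pair_pseudo_graphI) (auto simp: categorical_product_def sym_def)

lemma equiv_top_level_rel:
  "equiv (pverts (categorical_product G (looped_path r))) (top_level_rel G r)"
  by (rule equivI)
    (auto simp: top_level_rel_def categorical_product_def looped_path_def
      refl_on_def sym_def trans_def)

lemma pair_pseudo_graph_quotient_graph:
  assumes "pair_pseudo_graph G" "equiv (pverts G) R"
  shows "pair_pseudo_graph (quotient_graph G R)"
proof (rule pair_pseudo_graphI)
  note G = pair_pseudo_graphD[OF assms(1)]
  have "R \<subseteq> pverts G \<times> pverts G"
    using assms(2) by (auto simp: equiv_def refl_on_def)
  then show "finite (pverts (quotient_graph G R))"
    using G(1) by (simp add: quotient_graph_def finite_quotient)
  show "parcs (quotient_graph G R) \<subseteq>
      pverts (quotient_graph G R) \<times> pverts (quotient_graph G R)"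
    using G(2) by (auto simp: quotient_graph_def intro!: quotientI)
  show "sym (parcs (quotient_graph G R))"
    using G(3) by (auto simp: quotient_graph_def sym_def)
qed

lemma pair_pseudo_graph_generalised_mycielskian:
  "pair_pseudo_graph G \<Longrightarrow> pair_pseudo_graph (generalised_mycielskian r G)"
  unfolding generalised_mycielskian_def
  by (intro pair_pseudo_graph_quotient_graph equiv_top_level_rel
      pair_pseudo_graph_categorical_product pair_pseudo_graph_looped_path)


section \<open>Independence complexes and geometric realizations\<close>

text \<open>
  A simplicial complex is given by its set of simplices, the empty one included.
  A vertex carrying a loop is adjacent to itself, so it lies in no independent set.
\<close>

definition independence_complex :: "'a pair_pre_digraph \<Rightarrow> 'a set set" where
  "independence_complex G =
     {S. S \<subseteq> pverts G \<and> (\<forall>u\<in>S. \<forall>v\<in>S. (u, v) \<notin> parcs G)}"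

text \<open>
  Points of the realization are given by their barycentric coordinates. The topology
  is the subspace topology of the product topology on functions; for a complex with
  finitely many vertices, the only case used here, this is the usual (coherent)
  topology. The complex whose only simplex is empty is realized by the empty space.
\<close>

definition geometric_realization :: "'a set set \<Rightarrow> ('a \<Rightarrow> real) topology" where
  "geometric_realization K =
     top_of_set {x. (\<forall>v. 0 \<le> x v) \<and> {v. x v \<noteq> 0} \<in> K \<and> (\<Sum>v | x v \<noteq> 0. x v) = 1}"


section \<open>Suspension\<close>

text \<open>
  The (unreduced) suspension of \<open>X\<close> is the cylinder $X \times [0,1]$ with each end
  collapsed to a pole. Both poles are always present, so that the suspension of the
  empty space is the two-point discrete space $S^0$ (as for the join with $S^0$); for
  nonempty \<open>X\<close> it is the quotient of the cylinder, see
  \<open>quotient_map_suspension_proj\<close>.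
\<close>

datatype 'a suspension_point = South | North | Level 'a real

definition suspension_proj :: "'a \<times> real \<Rightarrow> 'a suspension_point" where
  "suspension_proj = (\<lambda>(x, t). if t \<le> 0 then South else if 1 \<le> t then North else Level x t)"

definition suspension_set :: "'a set \<Rightarrow> 'a suspension_point set" where
  "suspension_set S = {South, North} \<union> {Level x t |x t. x \<in> S \<and> 0 < t \<and> t < 1}"

definition suspension :: "'a topology \<Rightarrow> 'a suspension_point topology" where
  "suspension X = topology (\<lambda>U. U \<subseteq> suspension_set (topspace X) \<and>
     openin (prod_topology X (top_of_set {0..1}))
       {p \<in> topspace X \<times> {0..1}. suspension_proj p \<in> U})"

lemma openin_suspension:
  "openin (suspension X) U \<longleftrightarrow> U \<subseteq> suspension_set (topspace X) \<and>
     openin (prod_topology X (top_of_set {0..1}))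
       {p \<in> topspace X \<times> {0..1}. suspension_proj p \<in> U}"
proof -
  let ?C = "prod_topology X (top_of_set {0..1::real})"
  let ?pre = "\<lambda>U. {p \<in> topspace X \<times> {0..1}. suspension_proj p \<in> U}"
  have "istopology (\<lambda>U. U \<subseteq> suspension_set (topspace X) \<and> openin ?C (?pre U))"
    unfolding istopology_def
  proof (intro conjI allI impI)
    fix U V
    assume "U \<subseteq> suspension_set (topspace X) \<and> openin ?C (?pre U)"
      and "V \<subseteq> suspension_set (topspace X) \<and> openin ?C (?pre V)"
    moreover have "?pre (U \<inter> V) = ?pre U \<inter> ?pre V" by auto
    ultimately show "U \<inter> V \<subseteq> suspension_set (topspace X)" "openin ?C (?pre (U \<inter> V))"
      by auto
  next
    fix \<K>
    assume *: "\<forall>U\<in>\<K>. U \<subseteq> suspension_set (topspace X) \<and> openin ?C (?pre U)"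
    then show "\<Union>\<K> \<subseteq> suspension_set (topspace X)" by auto
    have "?pre (\<Union>\<K>) = (\<Union>U\<in>\<K>. ?pre U)" by auto
    with * show "openin ?C (?pre (\<Union>\<K>))" by auto
  qed
  then show ?thesis
    unfolding suspension_def by (simp add: topology_inverse')
qed

lemma suspension_proj_in_suspension_set:
  "p \<in> S \<times> {0..1} \<Longrightarrow> suspension_proj p \<in> suspension_set S"
  by (cases p) (auto simp: suspension_proj_def suspension_set_def split: if_splits)

lemma topspace_suspension: "topspace (suspension X) = suspension_set (topspace X)"
proof (rule subset_antisym)
  let ?S = "suspension_set (topspace X)"
  have "{p \<in> topspace X \<times> {0..1}. suspension_proj p \<in> ?S} = topspace X \<times> {0..1}"
    using suspension_proj_in_suspension_set by blast
  moreover have "openin (prod_topology X (top_of_set {0..1::real})) (topspace X \<times> {0..1})"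
    using openin_topspace[of "prod_topology X (top_of_set {0..1::real})"] by simp
  ultimately have "openin (suspension X) ?S"
    by (simp add: openin_suspension)
  then show "?S \<subseteq> topspace (suspension X)"
    by (rule openin_subset)
  show "topspace (suspension X) \<subseteq> ?S"
    using openin_topspace[of "suspension X"] unfolding openin_suspension by (rule conjunct1)
qed

lemma suspension_proj_surj:
  assumes "S \<noteq> {}"
  shows "suspension_proj ` (S \<times> {0..1}) = suspension_set S"
proof
  show "suspension_proj ` (S \<times> {0..1}) \<subseteq> suspension_set S"
    using suspension_proj_in_suspension_set by blast
  obtain a where a: "a \<in> S" using assms by auto
  show "suspension_set S \<subseteq> suspension_proj ` (S \<times> {0..1})"
  proof
    fix y assume "y \<in> suspension_set S"
    then consider "y = South" | "y = North"
      | x t where "y = Level x t" "x \<in> S" "0 < t" "t < 1"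
      by (auto simp: suspension_set_def)
    then show "y \<in> suspension_proj ` (S \<times> {0..1})"
    proof cases
      case 1
      then show ?thesis using a
        by (intro image_eqI[where x = "(a, 0)"]) (auto simp: suspension_proj_def)
    next
      case 2
      then show ?thesis using a
        by (intro image_eqI[where x = "(a, 1)"]) (auto simp: suspension_proj_def)
    next
      case (3 x t)
      then show ?thesis
        by (intro image_eqI[where x = "(x, t)"]) (auto simp: suspension_proj_def)
    qed
  qed
qed

lemma quotient_map_suspension_proj:
  assumes "topspace X \<noteq> {}"
  shows "quotient_map (prod_topology X (top_of_set {0..1})) (suspension X) suspension_proj"
  using suspension_proj_surj[OF assms]
  by (simp add: quotient_map_def topspace_suspension openin_suspension)

lemma suspension_empty:
  assumes "topspace X = {}"
  shows "suspension X = discrete_topology {South, North}"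
  by (auto simp: topology_eq openin_suspension assms suspension_set_def)

end

theory Submission
  imports Defs
begin

text \<open>
  Label the vertices of $M_2(G)$ as a lower copy of $G$, an upper copy, and the apex. If no vertex
  of $G$ is isolated, $\mathrm{Ind}(M_2(G))$ is the union of the cone over $\mathrm{Ind}(G)$ from the
  apex and the complex of independent sets avoiding the apex. In the latter, whenever the lower part
  $A$ is independent, the upper copy of $A$ may be added to the simplex, so it collapses to the full
  simplex on the upper level. Collapsing the upper level to a pole is therefore a homotopy
  equivalence to the join of $\mathrm{Ind}(G)$ with two points. The homotopies are all segments
  between points with a common carrier simplex. The apex is adjacent to the upper copy of a vertex
  only if that vertex has a neighbour; if there is an isolated vertex, both complexes are cones.
\<close>

section \<open>Realizations and contiguity\<close>

lemma topspace_geometric_realization: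
  "topspace (geometric_realization K) =
     {x. (\<forall>v. 0 \<le> x v) \<and> {v. x v \<noteq> 0} \<in> K \<and> (\<Sum>v | x v \<noteq> 0. x v) = 1}"
  by (simp add: geometric_realization_def)

text \<open>The realization is a subspace of a product of lines, so continuity can be checked one
  barycentric coordinate at a time. All continuity proofs below go through this criterion.\<close>

lemma continuous_map_into_geometric_realization:
  "continuous_map X (geometric_realization K) f \<longleftrightarrow>
     (\<forall>v. continuous_map X euclideanreal (\<lambda>p. f p v)) \<and>
     (\<forall>p\<in>topspace X. f p \<in> topspace (geometric_realization K))"
proof -
  have "continuous_map X (geometric_realization K) f \<longleftrightarrow>
      continuous_map X (product_topology (\<lambda>_. euclideanreal) UNIV) f \<and>
      (\<forall>p\<in>topspace X. f p \<in> topspace (geometric_realization K))"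
    unfolding topspace_geometric_realization
    by (auto simp: geometric_realization_def continuous_map_in_subtopology
        euclidean_product_topology Pi_iff)
  then show ?thesis
    by (simp only: continuous_map_componentwise_UNIV)
qed

lemma continuous_map_coordinate:
  assumes "continuous_map X (geometric_realization K) f"
  shows "continuous_map X euclideanreal (\<lambda>p. f p v)"
  using assms unfolding continuous_map_into_geometric_realization by blast

text \<open>Replaces the sum over the support, which varies with the point, by a sum over the fixed
  set \<open>V\<close>, which is linear in the coordinates.\<close>

lemma in_geometric_realization_iff:
  assumes "finite V" "\<Union>K \<subseteq> V"
  shows "x \<in> topspace (geometric_realization K) \<longleftrightarrow>
    (\<forall>v. 0 \<le> x v) \<and> {v. x v \<noteq> 0} \<in> K \<and> sum x V = 1"
proof -
  have "sum x {v. x v \<noteq> 0} = sum x V" if "{v. x v \<noteq> 0} \<in> K"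
    using that assms by (intro sum.mono_neutral_left) auto
  then show ?thesis
    by (auto simp: topspace_geometric_realization)
qed

lemma finite_support:
  assumes "x \<in> topspace (geometric_realization K)"
  shows "finite {v. x v \<noteq> 0}"
proof (rule ccontr)
  assume "infinite {v. x v \<noteq> 0}"
  \<comment> \<open>By convention a sum over an infinite set is 0, whereas barycentric coordinates
    sum to 1.\<close>
  then have "sum x {v. x v \<noteq> 0} = 0" by simp
  with assms show False by (simp add: topspace_geometric_realization)
qed

text \<open>The straight-line homotopy stays inside the complex: coordinates are nonnegative, so
  nothing cancels in the interior of a segment, and the support there is exactly the union of the
  supports of the two ends, a simplex by \<open>supp\<close>.\<close>

lemma homotopic_contiguous:
  assumes "continuous_map X (geometric_realization K) f"
    and "continuous_map X (geometric_realization K) g"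
    and supp: "\<And>p. p \<in> topspace X \<Longrightarrow> {v. f p v \<noteq> 0} \<union> {v. g p v \<noteq> 0} \<in> K"
  shows "homotopic_with (\<lambda>_. True) X (geometric_realization K) f g"
proof -
  let ?h = "\<lambda>(t, p) v. (1 - t) * f p v + t * g p v"
  have "?h (t, p) \<in> topspace (geometric_realization K)"
    if p: "p \<in> topspace X" and t: "0 \<le> t" "t \<le> 1" for t p
  proof -
    have f: "f p \<in> topspace (geometric_realization K)"
      and g: "g p \<in> topspace (geometric_realization K)"
      using assms(1,2) p by (auto simp: continuous_map_into_geometric_realization)
    have pos: "0 \<le> f p v" "0 \<le> g p v" for v
      using f g by (auto simp: topspace_geometric_realization)
    \<comment> \<open>The ends are split off because there the support is that of one map
      alone.\<close>
    consider "t = 0" | "t = 1" | "0 < t" "t < 1" using t by linarith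
    then show ?thesis
    proof cases
      case 3
      let ?U = "{v. f p v \<noteq> 0} \<union> {v. g p v \<noteq> 0}"
      have fin: "finite ?U" using finite_support f g by auto
      have "(1 - t) * f p v + t * g p v = 0 \<longleftrightarrow> f p v = 0 \<and> g p v = 0" for v
        using 3 pos[of v] by (subst add_nonneg_eq_0_iff) auto
      then have eq: "{v. ?h (t, p) v \<noteq> 0} = ?U" by auto
      have "sum (f p) ?U = sum (f p) {v. f p v \<noteq> 0}" "sum (g p) ?U = sum (g p) {v. g p v \<noteq> 0}"
        using fin by (auto intro!: sum.mono_neutral_right)
      then have "sum (f p) ?U = 1" "sum (g p) ?U = 1"
        using f g by (auto simp: topspace_geometric_realization)
      then have "(\<Sum>v\<in>?U. ?h (t, p) v) = 1"
        by (simp add: sum.distrib flip: sum_distrib_left)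
      then show ?thesis
        unfolding topspace_geometric_realization mem_Collect_eq eq
        using supp[OF p] pos 3 by auto
    qed (use f g in auto)
  qed
  moreover have "continuous_map (prod_topology (top_of_set {0..1}) X) euclideanreal (\<lambda>q. ?h q v)" for v
  proof -
    have "continuous_map (prod_topology (top_of_set {0..1::real}) X) euclideanreal fst"
      by (rule continuous_map_into_fulltopology[OF continuous_map_fst])
    moreover have "continuous_map (prod_topology (top_of_set {0..1::real}) X) euclideanreal (\<lambda>q. f (snd q) v)"
      "continuous_map (prod_topology (top_of_set {0..1::real}) X) euclideanreal (\<lambda>q. g (snd q) v)"
      using continuous_map_compose[OF continuous_map_snd continuous_map_coordinate[OF assms(1)]]
        continuous_map_compose[OF continuous_map_snd continuous_map_coordinate[OF assms(2)]]
      by (simp_all add: o_def)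
    ultimately show ?thesis
      unfolding case_prod_unfold by (auto intro!: continuous_intros)
  qed
  ultimately have "continuous_map (prod_topology (top_of_set {0..1}) X) (geometric_realization K) ?h"
    unfolding continuous_map_into_geometric_realization by auto
  then show ?thesis
    by (subst homotopic_with) (auto intro!: exI[of _ ?h])
qed

section \<open>Normalisation of weights\<close>

definition normalise :: "'a set \<Rightarrow> ('a \<Rightarrow> real) \<Rightarrow> 'a \<Rightarrow> real" where
  "normalise V x = (\<lambda>v. x v / sum x V)"

lemma
  assumes "finite V" "\<forall>v. 0 \<le> x v" "{v. x v \<noteq> 0} \<subseteq> V" "\<exists>v. x v \<noteq> 0"
  shows sum_pos_support: "0 < sum x V"
    and normalise_support: "{v. normalise V x v \<noteq> 0} = {v. x v \<noteq> 0}"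
proof -
  obtain w where "x w \<noteq> 0" using assms(4) by blast
  with assms show "0 < sum x V"
    by (intro sum_pos2[of _ w]) (auto simp: less_le)
  then show "{v. normalise V x v \<noteq> 0} = {v. x v \<noteq> 0}"
    by (simp add: normalise_def)
qed

text \<open>Dividing by a positive total leaves the support unchanged. Hence a map into a
  realization may be described by unnormalised nonnegative weights, provided that their supports are
  simplices and they never all vanish.\<close>

lemma continuous_map_normalise:
  assumes V: "finite V" "\<Union>K \<subseteq> V"
    and cont: "\<And>v. continuous_map X euclideanreal (\<lambda>p. f p v)"
    and pos: "\<And>p v. p \<in> topspace X \<Longrightarrow> 0 \<le> f p v"
    and supp: "\<And>p. p \<in> topspace X \<Longrightarrow> {v. f p v \<noteq> 0} \<in> K"
    and ne: "\<And>p. p \<in> topspace X \<Longrightarrow> \<exists>v. f p v \<noteq> 0"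
  shows "continuous_map X (geometric_realization K) (\<lambda>p. normalise V (f p))"
    and "p \<in> topspace X \<Longrightarrow> {v. normalise V (f p) v \<noteq> 0} = {v. f p v \<noteq> 0}"
proof -
  have sub: "{v. f p v \<noteq> 0} \<subseteq> V" if "p \<in> topspace X" for p
    using supp[OF that] V(2) by blast
  have S: "0 < sum (f p) V" if "p \<in> topspace X" for p
    using sum_pos_support[OF V(1)] pos sub ne that by simp
  show eq: "{v. normalise V (f p) v \<noteq> 0} = {v. f p v \<noteq> 0}" if "p \<in> topspace X" for p
    using normalise_support[OF V(1)] pos sub ne that by simp
  show "continuous_map X (geometric_realization K) (\<lambda>p. normalise V (f p))"
    unfolding continuous_map_into_geometric_realization
  proof (intro conjI allI ballI)
    show "continuous_map X euclideanreal (\<lambda>p. normalise V (f p) v)" for v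
      unfolding normalise_def
      by (intro continuous_intros cont V) (force dest: S)
    show "normalise V (f p) \<in> topspace (geometric_realization K)" if "p \<in> topspace X" for p
      unfolding in_geometric_realization_iff[OF V] eq[OF that]
      using S[OF that] pos[OF that] supp[OF that]
      by (auto simp: normalise_def simp flip: sum_divide_distrib intro!: divide_nonneg_pos)
  qed
qed

text \<open>Since \<open>a\<close> may be added to every simplex, the constant map at the vertex
  \<open>a\<close> is contiguous to the identity.\<close>

lemma cone_contraction:
  assumes "{} \<in> K" "\<And>S. S \<in> K \<Longrightarrow> insert a S \<in> K"
  shows "indicator {a} \<in> topspace (geometric_realization K)"
    and "homotopic_with (\<lambda>_. True) (geometric_realization K) (geometric_realization K)
      (\<lambda>_. indicator {a}) id"
proof -
  have supp: "{v. (indicator {a} v :: real) \<noteq> 0} = {a}"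
    by (auto simp: indicator_def)
  show a: "indicator {a} \<in> topspace (geometric_realization K)"
    unfolding topspace_geometric_realization mem_Collect_eq supp using assms by simp
  have "insert a {v. p v \<noteq> 0} \<in> K" if "p \<in> topspace (geometric_realization K)" for p
    using that assms(2) by (auto simp: topspace_geometric_realization)
  then show "homotopic_with (\<lambda>_. True) (geometric_realization K) (geometric_realization K)
      (\<lambda>_. indicator {a}) id"
    by (intro homotopic_contiguous) (simp_all add: a supp)
qed

text \<open>Both realizations contract to their cone points, so the constant maps at these points
  are mutually inverse up to homotopy.\<close>

lemma cones_homotopy_equivalent:
  assumes "{} \<in> K" "\<And>S. S \<in> K \<Longrightarrow> insert a S \<in> K"
    and "{} \<in> L" "\<And>S. S \<in> L \<Longrightarrow> insert b S \<in> L"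
  shows "geometric_realization K homotopy_equivalent_space geometric_realization L"
  unfolding homotopy_equivalent_space_def
proof (intro exI conjI)
  show "continuous_map (geometric_realization K) (geometric_realization L) (\<lambda>_. indicator {b})"
    "continuous_map (geometric_realization L) (geometric_realization K) (\<lambda>_. indicator {a})"
    using cone_contraction(1)[OF assms(1,2)] cone_contraction(1)[OF assms(3,4)] by simp_all
qed (use cone_contraction(2)[OF assms(1,2)] cone_contraction(2)[OF assms(3,4)] in
    \<open>simp_all add: o_def\<close>)

section \<open>Change of vertex labels\<close>

lemma realization_relabel:
  fixes \<phi> :: "'a \<Rightarrow> 'b"
  assumes "inj \<phi>"
  shows "geometric_realization ((`) \<phi> ` K) homeomorphic_space geometric_realization K"
proof -
  let ?f = "\<lambda>(x :: 'b \<Rightarrow> real) v. x (\<phi> v)"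
  \<comment> \<open>Labels outside the range of \<phi> lie in no simplex of the image complex, so
    their coordinate has to be 0.\<close>
  let ?g = "\<lambda>(y :: 'a \<Rightarrow> real) w. if w \<in> range \<phi> then y (inv \<phi> w) else 0"
  have f: "?f x \<in> topspace (geometric_realization K) \<and> ?g (?f x) = x"
    if x: "x \<in> topspace (geometric_realization ((`) \<phi> ` K))" for x
  proof -
    obtain S where S: "S \<in> K" "{w. x w \<noteq> 0} = \<phi> ` S"
      using x by (auto simp: topspace_geometric_realization)
    have "{v. x (\<phi> v) \<noteq> 0} = S"
      using S(2) injD[OF assms] by auto
    then have "?f x \<in> topspace (geometric_realization K)"
      using x S inj_on_subset[OF assms, of S]
      by (auto simp: topspace_geometric_realization sum.reindex)
    moreover have "?g (?f x) = x"
      using S(2) by (force simp: fun_eq_iff f_inv_into_f)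
    ultimately show ?thesis ..
  qed
  have g: "?g y \<in> topspace (geometric_realization ((`) \<phi> ` K))"
    if y: "y \<in> topspace (geometric_realization K)" for y
  proof -
    have "{w. ?g y w \<noteq> 0} = \<phi> ` {v. y v \<noteq> 0}"
      using assms by (auto simp: inv_f_f dest: injD)
    then show ?thesis
      using y inj_on_subset[OF assms, of "{v. y v \<noteq> 0}"] assms
      by (auto simp: topspace_geometric_realization sum.reindex inv_f_f)
  qed
  have "homeomorphic_maps (geometric_realization ((`) \<phi> ` K)) (geometric_realization K) ?f ?g"
    unfolding homeomorphic_maps_def continuous_map_into_geometric_realization
  proof (intro conjI allI ballI)
    show "continuous_map (geometric_realization ((`) \<phi> ` K)) euclideanreal (\<lambda>p. ?f p v)" for v
      by (rule continuous_map_coordinate[OF continuous_map_id, simplified id_def])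
    show "continuous_map (geometric_realization K) euclideanreal (\<lambda>p. ?g p w)" for w
      using continuous_map_coordinate[OF continuous_map_id, of K "inv \<phi> w"]
      by (cases "w \<in> range \<phi>") (auto simp: id_def)
  qed (use f g assms in \<open>auto simp: inv_f_f\<close>)
  then show ?thesis
    unfolding homeomorphic_space_def by blast
qed

text \<open>The realization is a finite union of closed simplices, each of them a closed subset of a
  cube that is compact by Tychonoff. Compactness serves below to make a continuous bijection a
  homeomorphism.\<close>

lemma compact_geometric_realization:
  assumes V: "finite V" "\<Union>K \<subseteq> V" and down: "\<And>S T. S \<in> K \<Longrightarrow> T \<subseteq> S \<Longrightarrow> T \<in> K"
  shows "compact_space (geometric_realization K)"
proof -
  \<comment> \<open>The closed simplex: coordinates in \<open>S\<close> may vanish, which makes the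
    conditions closed. Such points still belong to the realization because \<open>K\<close> is
    closed under subsets.\<close>
  define face where "face S = {x. (\<forall>v. x v \<in> {0..1::real}) \<and> (\<forall>v. v \<notin> S \<longrightarrow> x v = 0) \<and> sum x S = 1}" for S :: "'a set"
  have le1: "x v \<le> 1" if "x \<in> topspace (geometric_realization K)" for x v
    using that finite_support[OF that] member_le_sum[of v "{v. x v \<noteq> 0}" x]
    by (cases "x v = 0") (auto simp: topspace_geometric_realization)
  have "topspace (geometric_realization K) = (\<Union>S\<in>K. face S)"
  proof (intro subset_antisym subsetI)
    fix x assume x: "x \<in> topspace (geometric_realization K)"
    then have "x \<in> face {v. x v \<noteq> 0}"
      using le1[OF x] by (auto simp: face_def topspace_geometric_realization)
    then show "x \<in> (\<Union>S\<in>K. face S)"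
      using x by (auto simp: topspace_geometric_realization)
  next
    fix x assume "x \<in> (\<Union>S\<in>K. face S)"
    then obtain S where S: "S \<in> K" "x \<in> face S" by blast
    then have sub: "{v. x v \<noteq> 0} \<subseteq> S" by (auto simp: face_def)
    then have "sum x {v. x v \<noteq> 0} = sum x S"
      using S V by (intro sum.mono_neutral_left) (auto intro: finite_subset)
    then show "x \<in> topspace (geometric_realization K)"
      using S down[OF S(1) sub] by (auto simp: topspace_geometric_realization face_def)
  qed
  moreover have "compact (face S)" if "S \<in> K" for S
  proof -
    have "compact (PiE UNIV (\<lambda>_::'a. {0..1::real}))"
      using compactin_PiE[of "\<lambda>_. euclideanreal" UNIV "\<lambda>_::'a. {0..1::real}"]
      by (simp add: euclidean_product_topology)
    moreover have "closed {x. (\<forall>v. v \<notin> S \<longrightarrow> x v = 0) \<and> sum x S = (1::real)}"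
      by (intro closed_Collect_conj closed_Collect_all closed_Collect_imp closed_Collect_eq
          open_Collect_const continuous_intros continuous_on_product_coordinates)
    ultimately have "compact (PiE UNIV (\<lambda>_::'a. {0..1::real}) \<inter>
        {x. (\<forall>v. v \<notin> S \<longrightarrow> x v = 0) \<and> sum x S = (1::real)})"
      by (rule compact_Int_closed)
    then show ?thesis
      by (rule back_subst[of compact]) (auto simp: face_def PiE_def Pi_def)
  qed
  moreover have "finite K"
    using V by (meson Union_upper finite_Pow_iff PowI finite_subset subset_iff order_trans)
  ultimately have "compact (topspace (geometric_realization K))"
    by (auto intro!: compact_UN)
  then show ?thesis
    by (simp add: geometric_realization_def compact_space_subtopology)
qed

section \<open>The suspension of a realization\<close>

datatype 'a suspension_vertex = Equator 'a | South_Pole | North_Pole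

text \<open>The simplicial join of \<open>K\<close> with two points: a simplex of \<open>K\<close>
  together with at most one pole.\<close>

definition suspension_complex :: "'a set set \<Rightarrow> 'a suspension_vertex set set" where
  "suspension_complex K = {S. Equator -` S \<in> K \<and> (South_Pole \<notin> S \<or> North_Pole \<notin> S)}"

lemma suspension_complex_vertices:
  assumes "\<Union>K \<subseteq> V"
  shows "\<Union>(suspension_complex K) \<subseteq> insert South_Pole (insert North_Pole (Equator ` V))"
proof
  fix v assume "v \<in> \<Union>(suspension_complex K)"
  with assms show "v \<in> insert South_Pole (insert North_Pole (Equator ` V))"
    by (cases v) (auto simp: suspension_complex_def)
qed

lemma sum_suspension_vertices:
  fixes y :: "'a suspension_vertex \<Rightarrow> real"
  assumes "finite V"
  shows "sum y (insert South_Pole (insert North_Pole (Equator ` V))) =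
    y South_Pole + y North_Pole + (\<Sum>v\<in>V. y (Equator v))"
proof -
  have "sum y (Equator ` V) = (\<Sum>v\<in>V. y (Equator v))"
    by (subst sum.reindex) (auto simp: inj_on_def)
  moreover have "South_Pole \<notin> insert North_Pole (Equator ` V)" "North_Pole \<notin> Equator ` V"
    by auto
  ultimately show ?thesis
    using assms by simp
qed

lemma in_realization_suspension_complex:
  assumes V: "finite V" "\<Union>K \<subseteq> V"
  shows "y \<in> topspace (geometric_realization (suspension_complex K)) \<longleftrightarrow>
    (\<forall>v. 0 \<le> y v) \<and> {v. y (Equator v) \<noteq> 0} \<in> K \<and> (y South_Pole = 0 \<or> y North_Pole = 0) \<and>
    y South_Pole + y North_Pole + (\<Sum>v\<in>V. y (Equator v)) = 1"
proof -
  have "finite (insert South_Pole (insert North_Pole (Equator ` V)))"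
    using V by simp
  from in_geometric_realization_iff[OF this suspension_complex_vertices[OF V(2)]] show ?thesis
    by (simp add: sum_suspension_vertices[OF V(1)] suspension_complex_def vimage_def disj_imp)
qed

text \<open>Open sets of the suspension are defined through preimages in the cylinder, so continuity
  is tested there. The range condition is stated separately because over an empty space
  \<open>suspension_proj\<close> misses both poles.\<close>

lemma continuous_map_suspension:
  "continuous_map (suspension X) Y f \<longleftrightarrow>
     f \<in> topspace (suspension X) \<rightarrow> topspace Y \<and>
     continuous_map (prod_topology X (top_of_set {0..1})) Y (f \<circ> suspension_proj)"
    (is "?L \<longleftrightarrow> ?F \<and> ?R")
proof (cases ?F)
  case True
  have eq: "{p \<in> topspace X \<times> {0..1}. suspension_proj p \<in> {z \<in> topspace (suspension X). f z \<in> U}} =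
      {p \<in> topspace X \<times> {0..1}. f (suspension_proj p) \<in> U}" for U
    using suspension_proj_in_suspension_set[of _ "topspace X"] by (auto simp: topspace_suspension)
  have "f (suspension_proj p) \<in> topspace Y" if "p \<in> topspace X \<times> {0..1}" for p
    using True suspension_proj_in_suspension_set[OF that] by (auto simp: topspace_suspension)
  then show ?thesis
    unfolding continuous_map_def openin_suspension eq
    using True by (auto simp: topspace_suspension Pi_iff)
qed (auto simp: continuous_map_def)

lemma compact_space_suspension:
  assumes "compact_space X"
  shows "compact_space (suspension X)"
proof (cases "topspace X = {}")
  case True
  then show ?thesis
    by (simp add: suspension_empty compact_space_discrete_topology)
next
  case False
  have "compact_space (prod_topology X (top_of_set {0..1::real}))"
    using assms by (simp add: compact_space_prod_topology compact_space_subtopology)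
  then show ?thesis
    using quotient_map_suspension_proj[OF False] by (metis compact_space_def image_compactin
        quotient_imp_continuous_map quotient_imp_surjective_map)
qed

text \<open>The path from the south pole through \<open>x\<close> at time 1/2 to the north pole,
  linear on each half. The equatorial factor and the two pole weights always add up to 1.\<close>

definition join_coordinates :: "('a \<Rightarrow> real) \<Rightarrow> real \<Rightarrow> 'a suspension_vertex \<Rightarrow> real" where
  "join_coordinates x t = case_suspension_vertex
     (\<lambda>v. (1 - \<bar>2 * t - 1\<bar>) * x v) (max 0 (1 - 2 * t)) (max 0 (2 * t - 1))"

lemma join_coordinates_simps [simp]:
  "join_coordinates x t (Equator v) = (1 - \<bar>2 * t - 1\<bar>) * x v"
  "join_coordinates x t South_Pole = max 0 (1 - 2 * t)"
  "join_coordinates x t North_Pole = max 0 (2 * t - 1)"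
  by (simp_all add: join_coordinates_def)

text \<open>The difference of the pole weights is \<open>2 * t - 1\<close>, which determines
  \<open>t\<close>. Away from the ends the factor of \<open>x\<close> is nonzero, so
  \<open>x\<close> can be recovered too; at the ends it is lost, just as in the suspension.\<close>

lemma join_coordinates_inject:
  assumes "join_coordinates x t = join_coordinates x' t'"
  shows "t = t'" and "0 < t \<Longrightarrow> t < 1 \<Longrightarrow> x = x'"
proof -
  show "t = t'"
    using fun_cong[OF assms, of South_Pole] fun_cong[OF assms, of North_Pole]
    by (auto simp: max_def split: if_splits)
  assume "0 < t" "t < 1"
  then have "1 - \<bar>2 * t - 1\<bar> \<noteq> 0" by linarith
  then show "x = x'"
    using fun_cong[OF assms, of "Equator v" for v] \<open>t = t'\<close> by (auto simp: fun_eq_iff)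
qed

text \<open>Join coordinates give a continuous bijection from a compact space to a Hausdorff space,
  so continuity of the inverse comes for free.\<close>

lemma suspension_realization:
  assumes V: "finite V" "\<Union>K \<subseteq> V" and "{} \<in> K"
    and down: "\<And>S T. S \<in> K \<Longrightarrow> T \<subseteq> S \<Longrightarrow> T \<in> K"
  shows "suspension (geometric_realization K) homeomorphic_space
    geometric_realization (suspension_complex K)"
proof -
  let ?X = "geometric_realization K" and ?Y = "geometric_realization (suspension_complex K)"
  \<comment> \<open>At the poles the factor of the first argument is 0, so the zero function can
    stand in for a point of the realization. This also works when the realization is empty.\<close>
  define \<Phi> where "\<Phi> = case_suspension_point (join_coordinates (\<lambda>_::'a. 0) 0)
    (join_coordinates (\<lambda>_. 0) 1) join_coordinates"
  note Y_iff = in_realization_suspension_complex[OF V]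
  have \<Phi>_proj: "\<Phi> (suspension_proj (x, t)) = join_coordinates x t" if "t \<in> {0..1}" for x t
    using that by (auto simp: \<Phi>_def suspension_proj_def join_coordinates_def)
  have join: "join_coordinates x t \<in> topspace ?Y"
    if "x \<in> topspace ?X" "0 < t" "t < 1" for x t
  proof -
    have x: "\<forall>v. 0 \<le> x v" "{v. x v \<noteq> 0} \<in> K" "sum x V = 1"
      using that in_geometric_realization_iff[OF V] by auto
    have *: "0 < 1 - \<bar>2 * t - 1\<bar>" using that by linarith
    have "0 \<le> join_coordinates x t v" for v
      using x(1) * by (cases v) auto
    moreover have "{v. join_coordinates x t (Equator v) \<noteq> 0} = {v. x v \<noteq> 0}"
      using * by auto
    moreover have "(\<Sum>v\<in>V. join_coordinates x t (Equator v)) = 1 - \<bar>2 * t - 1\<bar>"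
      using x(3) by (simp flip: sum_distrib_left)
    ultimately show ?thesis
      using x(2) unfolding Y_iff by (simp add: max_def abs_if)
  qed
  have poles: "join_coordinates (\<lambda>_. 0) 0 \<in> topspace ?Y" "join_coordinates (\<lambda>_. 0) 1 \<in> topspace ?Y"
  proof -
    have "0 \<le> join_coordinates (\<lambda>_::'a. 0) 0 v" "0 \<le> join_coordinates (\<lambda>_::'a. 0) 1 v" for v
      by (cases v; simp)+
    then show "join_coordinates (\<lambda>_. 0) 0 \<in> topspace ?Y" "join_coordinates (\<lambda>_. 0) 1 \<in> topspace ?Y"
      using \<open>{} \<in> K\<close> unfolding Y_iff by simp_all
  qed
  have maps: "\<Phi> \<in> topspace (suspension ?X) \<rightarrow> topspace ?Y"
    using join poles by (auto simp: topspace_suspension suspension_set_def \<Phi>_def)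
  have join': "join_coordinates x t \<in> topspace ?Y" if "x \<in> topspace ?X" "t \<in> {0..1}" for x t
  proof -
    have "suspension_proj (x, t) \<in> topspace (suspension ?X)"
      unfolding topspace_suspension using that by (intro suspension_proj_in_suspension_set) simp
    then show ?thesis
      unfolding \<Phi>_proj[OF that(2), symmetric] by (rule funcset_mem[OF maps])
  qed
  have "homeomorphic_map (suspension ?X) ?Y \<Phi>"
  proof (rule continuous_imp_homeomorphic_map)
    show "compact_space (suspension ?X)"
      by (intro compact_space_suspension compact_geometric_realization[OF V]) (rule down)
    show "Hausdorff_space ?Y"
      unfolding geometric_realization_def euclidean_product_topology[symmetric]
      by (simp add: Hausdorff_space_subtopology Hausdorff_space_product_topology)
    let ?C = "prod_topology ?X (top_of_set {0..1::real})"
    have fst: "continuous_map ?C euclideanreal (\<lambda>p. fst p v)" for v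
      by (rule continuous_map_coordinate[OF continuous_map_fst])
    have snd: "continuous_map ?C euclideanreal snd"
      by (rule continuous_map_into_fulltopology[OF continuous_map_snd])
    have "continuous_map ?C ?Y (\<lambda>p. join_coordinates (fst p) (snd p))"
      unfolding continuous_map_into_geometric_realization
    proof (intro conjI allI ballI)
      show "continuous_map ?C euclideanreal (\<lambda>p. join_coordinates (fst p) (snd p) w)" for w
        using fst snd by (cases w) (auto intro!: continuous_intros)
      show "join_coordinates (fst p) (snd p) \<in> topspace ?Y" if "p \<in> topspace ?C" for p
        using that by (intro join') auto
    qed
    then have "continuous_map ?C ?Y (\<Phi> \<circ> suspension_proj)"
      by (rule continuous_map_eq) (auto simp: \<Phi>_proj)
    then show "continuous_map (suspension ?X) ?Y \<Phi>"
      using maps by (simp add: continuous_map_suspension)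
    show "inj_on \<Phi> (topspace (suspension ?X))"
      by (rule inj_onI)
        (auto simp: \<Phi>_def topspace_suspension suspension_set_def dest!: join_coordinates_inject(1)
          intro: join_coordinates_inject(2))
    show "\<Phi> ` topspace (suspension ?X) = topspace ?Y"
    proof (intro subset_antisym subsetI)
      fix y assume "y \<in> topspace ?Y"
      then have y: "\<And>v. 0 \<le> y v" "{v. y (Equator v) \<noteq> 0} \<in> K" "y South_Pole = 0 \<or> y North_Pole = 0"
        "y South_Pole + y North_Pole + (\<Sum>v\<in>V. y (Equator v)) = 1"
        unfolding Y_iff by blast+
      \<comment> \<open>Solves \<open>2 * t - 1\<close> = north weight minus south weight. As one
        pole weight is 0, the remaining mass \<open>m\<close> is then the equatorial factor at
        \<open>t\<close>.\<close>
      define t where "t = (1 - y South_Pole + y North_Pole) / 2"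
      define m where "m = (\<Sum>v\<in>V. y (Equator v))"
      have m0: "0 \<le> m" using y(1) by (simp add: m_def sum_nonneg)
      have t: "0 \<le> t" "t \<le> 1" "m = 1 - \<bar>2 * t - 1\<bar>"
        "y South_Pole = max 0 (1 - 2 * t)" "y North_Pole = max 0 (2 * t - 1)"
      proof -
        have "2 * t = 1 - y South_Pole + y North_Pole" "y South_Pole + y North_Pole + m = 1"
          using y(4) by (simp_all add: t_def m_def)
        then show "0 \<le> t" "t \<le> 1" "m = 1 - \<bar>2 * t - 1\<bar>"
          "y South_Pole = max 0 (1 - 2 * t)" "y North_Pole = max 0 (2 * t - 1)"
          using y(1)[of South_Pole] y(1)[of North_Pole] y(3) m0 by linarith+
      qed
      have yE: "y (Equator v) = 0" if "v \<notin> V" for v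
        using y(2) that V(2) by blast
      have "\<exists>z\<in>topspace (suspension ?X). \<Phi> z = y"
      \<comment> \<open>Without equatorial mass the point is a pole; otherwise dividing by
        \<open>m\<close> gives its position in the realization of \<open>K\<close>.\<close>
      proof (cases "m = 0")
        case True
        then have "\<forall>v\<in>V. y (Equator v) = 0"
          unfolding m_def using sum_nonneg_eq_0_iff[OF V(1), of "\<lambda>v. y (Equator v)"] y(1) by blast
        then have "y (Equator v) = 0" for v
          using yE by blast
        then have "join_coordinates (\<lambda>_. 0) t = y"
          using t by (intro ext, rename_tac w, case_tac w) auto
        moreover have "t = 0 \<or> t = 1"
          using t True by linarith
        ultimately show ?thesis
          by (auto simp: \<Phi>_def topspace_suspension suspension_set_def)
      next
        case False
        define x where "x = (\<lambda>v. y (Equator v) / m)"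
        have "x \<in> topspace ?X"
          using y False m0 unfolding in_geometric_realization_iff[OF V]
          by (simp add: x_def m_def flip: sum_divide_distrib)
        moreover have "0 < t" "t < 1"
          using t False m0 by linarith+
        moreover have "join_coordinates x t w = y w" for w
          using t False by (cases w) (simp_all add: x_def)
        ultimately show ?thesis
          by (intro bexI[of _ "Level x t"]) (auto simp: \<Phi>_def topspace_suspension suspension_set_def)
      qed
      then show "y \<in> \<Phi> ` topspace (suspension ?X)" by blast
    qed (use maps in auto)
  qed
  then show ?thesis
    by (rule homeomorphic_map_imp_homeomorphic_space)
qed

section \<open>The Mycielskian with labelled levels\<close>

datatype 'a mycielskian_vertex = Lower 'a | Upper 'a | Apex

text \<open>An explicit model of the quotient graph that allows case distinction on the level. The
  looped path has its only loop at 0, hence there are no arcs within the upper level.\<close>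

definition levelled_mycielskian ::
  "'a pair_pre_digraph \<Rightarrow> 'a mycielskian_vertex pair_pre_digraph" where
  "levelled_mycielskian G = \<lparr> pverts = insert Apex (Lower ` pverts G \<union> Upper ` pverts G),
     parcs = (\<Union>(u, v)\<in>parcs G. {(Lower u, Lower v), (Lower u, Upper v), (Upper u, Lower v),
       (Upper u, Apex), (Apex, Upper v)}) \<rparr>"

definition level_class :: "'a pair_pre_digraph \<Rightarrow> 'a mycielskian_vertex \<Rightarrow> ('a \<times> nat) set" where
  "level_class G = case_mycielskian_vertex (\<lambda>g. {(g, 0)}) (\<lambda>g. {(g, 1)}) (pverts G \<times> {2})"

lemma level_class_simps [simp]:
  "level_class G (Lower g) = {(g, 0)}"
  "level_class G (Upper g) = {(g, 1)}"
  "level_class G Apex = pverts G \<times> {2}"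
  by (simp_all add: level_class_def)

lemma inj_level_class:
  assumes "pverts G \<noteq> {}"
  shows "inj (level_class G)"
proof (rule injI)
  fix u v assume eq: "level_class G u = level_class G v"
  \<comment> \<open>The second coordinates occurring in a class reveal its level. Nonemptiness of
    \<open>pverts G\<close> ensures that the class of \<open>Apex\<close> has one.\<close>
  have "snd ` level_class G w = {case_mycielskian_vertex (\<lambda>_. 0) (\<lambda>_. 1) 2 w}" for w
    using assms by (cases w) auto
  from this[of u] this[of v] eq show "u = v"
    by (cases u; cases v) simp_all
qed

lemma top_level_rel_class:
  assumes "g \<in> pverts G"
  shows "top_level_rel G 2 `` {(g, 0)} = level_class G (Lower g)"
    and "top_level_rel G 2 `` {(g, 1)} = level_class G (Upper g)"
    and "top_level_rel G 2 `` {(g, 2)} = level_class G Apex"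
  using assms by (auto simp: top_level_rel_def)

text \<open>Only level 2 is identified, to a class that exists because \<open>G\<close> has a
  vertex; the other classes are singletons. Each arc of \<open>G\<close> yields five arcs, one for
  every arc of \<open>looped_path 2\<close>.\<close>

lemma mycielskian_levels:
  assumes G: "parcs G \<subseteq> pverts G \<times> pverts G" and ne: "pverts G \<noteq> {}"
  shows "mycielskian G = \<lparr> pverts = level_class G ` pverts (levelled_mycielskian G),
    parcs = map_prod (level_class G) (level_class G) ` parcs (levelled_mycielskian G) \<rparr>"
proof -
  let ?R = "top_level_rel G 2" and ?c = "level_class G"
  have levels: "{0..2::nat} = {0, 1, 2}" by auto
  have "(pverts G \<times> {0..2}) // ?R =
      (\<Union>g\<in>pverts G. {?R `` {(g, 0)}, ?R `` {(g, 1)}, ?R `` {(g, 2)}})"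
    unfolding quotient_def levels by auto
  also have "\<dots> = (\<Union>g\<in>pverts G. {?c (Lower g), ?c (Upper g), ?c Apex})"
    by (intro SUP_cong refl) (simp only: top_level_rel_class)
  also have "\<dots> = ?c ` pverts (levelled_mycielskian G)"
    unfolding levelled_mycielskian_def using ne by (auto simp del: level_class_simps)
  finally have verts: "(pverts G \<times> {0..2}) // ?R = ?c ` pverts (levelled_mycielskian G)" .
  have path: "parcs (looped_path 2) = {(0, 0), (0, 1), (1, 0), (1, 2), (2, 1)}"
    by (auto simp: looped_path_def less_2_cases_iff)
  have "{(?R `` {p}, ?R `` {q}) |p q. (p, q) \<in> parcs (categorical_product G (looped_path 2))} =
      (\<Union>(u, v)\<in>parcs G. \<Union>(i, j)\<in>parcs (looped_path 2). {(?R `` {(u, i)}, ?R `` {(v, j)})})"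
    by (fastforce simp: categorical_product_def)
  also have "\<dots> = (\<Union>(u, v)\<in>parcs G. {(?R `` {(u, 0)}, ?R `` {(v, 0)}), (?R `` {(u, 0)}, ?R `` {(v, 1)}),
      (?R `` {(u, 1)}, ?R `` {(v, 0)}), (?R `` {(u, 1)}, ?R `` {(v, 2)}), (?R `` {(u, 2)}, ?R `` {(v, 1)})})"
    unfolding path by (intro SUP_cong refl) auto
  also have "\<dots> = (\<Union>(u, v)\<in>parcs G. {(?c (Lower u), ?c (Lower v)), (?c (Lower u), ?c (Upper v)),
      (?c (Upper u), ?c (Lower v)), (?c (Upper u), ?c Apex), (?c Apex, ?c (Upper v))})"
  proof (intro SUP_cong refl, clarify)
    fix u v assume "(u, v) \<in> parcs G"
    then have "u \<in> pverts G" "v \<in> pverts G" using G by auto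
    then show "{(?R `` {(u, 0)}, ?R `` {(v, 0)}), (?R `` {(u, 0)}, ?R `` {(v, 1)}),
        (?R `` {(u, 1)}, ?R `` {(v, 0)}), (?R `` {(u, 1)}, ?R `` {(v, 2)}), (?R `` {(u, 2)}, ?R `` {(v, 1)})} =
      {(?c (Lower u), ?c (Lower v)), (?c (Lower u), ?c (Upper v)),
        (?c (Upper u), ?c (Lower v)), (?c (Upper u), ?c Apex), (?c Apex, ?c (Upper v))}"
      by (simp only: top_level_rel_class)
  qed
  also have "\<dots> = map_prod ?c ?c ` parcs (levelled_mycielskian G)"
    by (simp add: levelled_mycielskian_def image_UN case_prod_unfold)
  finally have arcs: "{(?R `` {p}, ?R `` {q}) |p q. (p, q) \<in> parcs (categorical_product G (looped_path 2))} =
      map_prod ?c ?c ` parcs (levelled_mycielskian G)" .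
  have "pverts (categorical_product G (looped_path 2)) = pverts G \<times> {0..2}"
    by (simp add: categorical_product_def looped_path_def)
  then show ?thesis
    unfolding generalised_mycielskian_def quotient_graph_def by (simp only: verts arcs)
qed

section \<open>Independent sets on the three levels\<close>

lemma independence_complex_relabel:
  assumes "inj \<phi>"
  shows "independence_complex \<lparr> pverts = \<phi> ` pverts H, parcs = map_prod \<phi> \<phi> ` parcs H \<rparr> =
    (`) \<phi> ` independence_complex H"
proof (intro set_eqI iffI)
  have arcs: "(\<phi> u, \<phi> v) \<in> map_prod \<phi> \<phi> ` parcs H \<longleftrightarrow> (u, v) \<in> parcs H" for u v
    using inj_image_mem_iff[OF prod.inj_map[OF assms assms], of "(u, v)"] by simp
  show "S \<in> (`) \<phi> ` independence_complex H"
    if "S \<in> independence_complex \<lparr> pverts = \<phi> ` pverts H, parcs = map_prod \<phi> \<phi> ` parcs H \<rparr>" for S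
  proof -
    from that obtain T where T: "T \<subseteq> pverts H" "S = \<phi> ` T"
      unfolding independence_complex_def by (auto simp: subset_image_iff)
    then show ?thesis
      using that by (auto simp: independence_complex_def arcs)
  qed
  show "S \<in> independence_complex \<lparr> pverts = \<phi> ` pverts H, parcs = map_prod \<phi> \<phi> ` parcs H \<rparr>"
    if "S \<in> (`) \<phi> ` independence_complex H" for S
  proof -
    from that obtain T where T: "T \<in> independence_complex H" "S = \<phi> ` T" by blast
    then have "\<forall>u\<in>T. \<forall>v\<in>T. (\<phi> u, \<phi> v) \<notin> map_prod \<phi> \<phi> ` parcs H"
      unfolding arcs by (simp add: independence_complex_def)
    with T show ?thesis
      unfolding independence_complex_def by simp blast
  qed
qed

lemma realization_mycielskian_levels:
  assumes "parcs G \<subseteq> pverts G \<times> pverts G" "pverts G \<noteq> {}"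
  shows "geometric_realization (independence_complex (mycielskian G)) homeomorphic_space
    geometric_realization (independence_complex (levelled_mycielskian G))"
  unfolding mycielskian_levels[OF assms] independence_complex_relabel[OF inj_level_class[OF assms(2)]]
  by (rule realization_relabel[OF inj_level_class[OF assms(2)]])

lemma independence_complex_subset:
  "S \<in> independence_complex G \<Longrightarrow> T \<subseteq> S \<Longrightarrow> T \<in> independence_complex G"
  by (auto simp: independence_complex_def)

lemma Union_independence_complex: "\<Union>(independence_complex G) \<subseteq> pverts G"
  by (auto simp: independence_complex_def)

text \<open>Symmetry merges the two directions of the arcs between the lower and upper levels, and
  likewise those at \<open>Apex\<close>. An upper vertex excludes \<open>Apex\<close> exactly when
  the underlying vertex has a neighbour, possibly itself through a loop.\<close>

lemma independence_complex_levels: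
  assumes "sym (parcs G)"
  shows "S \<in> independence_complex (levelled_mycielskian G) \<longleftrightarrow>
    Lower -` S \<in> independence_complex G \<and> Upper -` S \<subseteq> pverts G \<and>
    (\<forall>a b. Lower a \<in> S \<longrightarrow> Upper b \<in> S \<longrightarrow> (a, b) \<notin> parcs G) \<and>
    (Apex \<in> S \<longrightarrow> (\<forall>b c. Upper b \<in> S \<longrightarrow> (b, c) \<notin> parcs G))"
proof -
  have verts: "S \<subseteq> pverts (levelled_mycielskian G) \<longleftrightarrow>
      Lower -` S \<subseteq> pverts G \<and> Upper -` S \<subseteq> pverts G"
  proof (intro iffI subsetI)
    fix v assume "Lower -` S \<subseteq> pverts G \<and> Upper -` S \<subseteq> pverts G" "v \<in> S"
    then show "v \<in> pverts (levelled_mycielskian G)"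
      by (cases v) (auto simp: levelled_mycielskian_def)
  qed (auto simp: levelled_mycielskian_def)
  have arcs: "(\<forall>u\<in>S. \<forall>v\<in>S. (u, v) \<notin> parcs (levelled_mycielskian G)) \<longleftrightarrow>
      (\<forall>a b. (a, b) \<in> parcs G \<longrightarrow> \<not> (Lower a \<in> S \<and> Lower b \<in> S) \<and> \<not> (Lower a \<in> S \<and> Upper b \<in> S) \<and>
        \<not> (Upper a \<in> S \<and> Lower b \<in> S) \<and> \<not> (Upper a \<in> S \<and> Apex \<in> S) \<and> \<not> (Apex \<in> S \<and> Upper b \<in> S))"
    by (simp add: levelled_mycielskian_def) blast
  show ?thesis
    using assms unfolding independence_complex_def mem_Collect_eq verts arcs
    by (auto dest: symD)
qed

lemma finite_levelled_mycielskian: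
  "finite (pverts G) \<Longrightarrow> finite (pverts (levelled_mycielskian G))"
  by (simp add: levelled_mycielskian_def)

lemma sum_levels:
  fixes p :: "'a mycielskian_vertex \<Rightarrow> real"
  assumes "finite (pverts G)"
  shows "sum p (pverts (levelled_mycielskian G)) =
    p Apex + (\<Sum>v\<in>pverts G. p (Lower v)) + (\<Sum>v\<in>pverts G. p (Upper v))"
proof -
  let ?V = "pverts G"
  have "sum p (Lower ` ?V \<union> Upper ` ?V) = sum p (Lower ` ?V) + sum p (Upper ` ?V)"
    using assms by (intro sum.union_disjoint) auto
  moreover have "sum p (Lower ` ?V) = (\<Sum>v\<in>?V. p (Lower v))" "sum p (Upper ` ?V) = (\<Sum>v\<in>?V. p (Upper v))"
    by (subst sum.reindex; auto simp: inj_on_def)+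
  moreover have "Apex \<notin> Lower ` ?V \<union> Upper ` ?V" by auto
  ultimately show ?thesis
    using assms by (simp add: levelled_mycielskian_def)
qed

section \<open>The homotopy equivalence\<close>

text \<open>
  A section, up to homotopy and normalisation, of the collapse of the upper level to a pole:
  as the weight \<open>s\<close> of that pole grows to $1/2$, the point \<open>x\<close> is pushed from the lower to the
  upper level; only afterwards is the weight \<open>b\<close> turned on, when no lower vertex is left that
  could be adjacent to its support.
\<close>

definition lift_levels ::
  "('a \<Rightarrow> real) \<Rightarrow> real \<Rightarrow> ('a \<Rightarrow> real) \<Rightarrow> real \<Rightarrow> 'a mycielskian_vertex \<Rightarrow> real" where
  "lift_levels x s b z = case_mycielskian_vertex (\<lambda>v. max 0 (1 - 2 * s) * x v)
     (\<lambda>v. s * x v + max 0 (2 * s - 1) * b v) z"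

lemma lift_levels_simps [simp]:
  "lift_levels x s b z (Lower v) = max 0 (1 - 2 * s) * x v"
  "lift_levels x s b z (Upper v) = s * x v + max 0 (2 * s - 1) * b v"
  "lift_levels x s b z Apex = z"
  by (simp_all add: lift_levels_def)

section \<open>The collapse and its homotopy inverse\<close>

locale graph_without_isolated_vertices =
  fixes G :: "'a pair_pre_digraph"
  assumes graph: "pair_pseudo_graph G"
    and neighbour: "\<And>u. u \<in> pverts G \<Longrightarrow> \<exists>v. (u, v) \<in> parcs G"
begin

abbreviation "V \<equiv> pverts G"
abbreviation "E \<equiv> parcs G"
abbreviation "W \<equiv> pverts (levelled_mycielskian G)"
abbreviation "K \<equiv> independence_complex G"
abbreviation "M \<equiv> independence_complex (levelled_mycielskian G)"
abbreviation "L \<equiv> suspension_complex K"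

lemmas G = pair_pseudo_graphD[OF graph]
lemmas fin = G(1) Union_independence_complex[of G]
lemmas finW = finite_levelled_mycielskian[OF G(1)] Union_independence_complex[of "levelled_mycielskian G"]

text \<open>Every vertex has a neighbour, so \<open>Apex\<close> is adjacent to the entire upper
  level.\<close>

lemma M_iff:
  "S \<in> M \<longleftrightarrow> Lower -` S \<in> K \<and> Upper -` S \<subseteq> V \<and>
    (\<forall>a b. Lower a \<in> S \<longrightarrow> Upper b \<in> S \<longrightarrow> (a, b) \<notin> E) \<and> (Apex \<in> S \<longrightarrow> Upper -` S = {})"
  unfolding independence_complex_levels[OF G(3)] using neighbour by blast

lemma realization_M_D:
  assumes "p \<in> topspace (geometric_realization M)"
  shows "0 \<le> p w" and "{v. p (Lower v) \<noteq> 0} \<in> K" and "{v. p (Upper v) \<noteq> 0} \<subseteq> V"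
    and "p (Lower a) \<noteq> 0 \<Longrightarrow> p (Upper b) \<noteq> 0 \<Longrightarrow> (a, b) \<notin> E"
    and "p Apex \<noteq> 0 \<Longrightarrow> p (Upper b) = 0"
    and "p Apex + (\<Sum>v\<in>V. p (Lower v)) + (\<Sum>v\<in>V. p (Upper v)) = 1"
  using assms unfolding in_geometric_realization_iff[OF finW] sum_levels[OF G(1)] M_iff
  by (auto simp: vimage_def)

text \<open>The linear extension of the simplicial map that keeps the lower level, sends all upper
  vertices to the south pole and sends the apex to the north pole.\<close>

definition collapse :: "('a mycielskian_vertex \<Rightarrow> real) \<Rightarrow> 'a suspension_vertex \<Rightarrow> real" where
  "collapse p = case_suspension_vertex (\<lambda>v. p (Lower v)) (\<Sum>v\<in>V. p (Upper v)) (p Apex)"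

lemma collapse_simps [simp]:
  "collapse p (Equator v) = p (Lower v)"
  "collapse p South_Pole = (\<Sum>v\<in>V. p (Upper v))"
  "collapse p North_Pole = p Apex"
  by (simp_all add: collapse_def)

lemma collapse_realization:
  assumes p: "p \<in> topspace (geometric_realization M)"
  shows "collapse p \<in> topspace (geometric_realization L)"
proof -
  note p = realization_M_D[OF p]
  have "0 \<le> collapse p v" for v
    using p(1) by (cases v) (auto intro!: sum_nonneg)
  moreover have "(\<Sum>v\<in>V. p (Upper v)) = 0 \<or> p Apex = 0"
    using p(5) by (cases "p Apex = 0") auto
  ultimately show ?thesis
    using p(2,6) unfolding in_realization_suspension_complex[OF fin] by simp
qed

lemma continuous_map_collapse:
  "continuous_map (geometric_realization M) (geometric_realization L) collapse"
  unfolding continuous_map_into_geometric_realization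
proof (intro conjI allI ballI)
  have coord: "continuous_map (geometric_realization M) euclideanreal (\<lambda>p. p w)" for w
    using continuous_map_coordinate[OF continuous_map_id] by (simp add: id_def)
  show "continuous_map (geometric_realization M) euclideanreal (\<lambda>p. collapse p v)" for v
    by (cases v) (auto intro!: coord continuous_map_sum G(1))
qed (rule collapse_realization)

text \<open>If a lower weight is nonzero, then \<open>2 * s < 1\<close>, so \<open>b\<close> is
  switched off and both levels are supported on the independent support of \<open>x\<close>. If the
  apex weight is nonzero, then \<open>s = 0\<close> and all upper weights vanish.\<close>

lemma lift_levels_M:
  assumes x: "{v. x v \<noteq> 0} \<in> K" and b: "{v. b v \<noteq> 0} \<subseteq> V" and z: "z = 0 \<or> s = 0"
  shows "{w. lift_levels x s b z w \<noteq> 0} \<in> M"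
proof -
  have V: "{v. x v \<noteq> 0} \<subseteq> V" using x by (auto simp: independence_complex_def)
  have "Lower -` {w. lift_levels x s b z w \<noteq> 0} \<subseteq> {v. x v \<noteq> 0}" by auto
  then have "Lower -` {w. lift_levels x s b z w \<noteq> 0} \<in> K"
    by (rule independence_complex_subset[OF x])
  moreover have "Upper -` {w. lift_levels x s b z w \<noteq> 0} \<subseteq> V"
  proof -
    have "Upper -` {w. lift_levels x s b z w \<noteq> 0} \<subseteq> {v. x v \<noteq> 0} \<union> {v. b v \<noteq> 0}" by auto
    then show ?thesis using V b by blast
  qed
  moreover have "(u, v) \<notin> E" if "lift_levels x s b z (Lower u) \<noteq> 0" "lift_levels x s b z (Upper v) \<noteq> 0" for u v
  proof -
    have "2 * s < 1" "x u \<noteq> 0" using that(1) by (auto simp: max_def split: if_splits)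
    moreover from this have "x v \<noteq> 0" using that(2) by (auto simp: max_def)
    ultimately show ?thesis using x by (auto simp: independence_complex_def)
  qed
  moreover have "Upper -` {w. lift_levels x s b z w \<noteq> 0} = {}" if "lift_levels x s b z Apex \<noteq> 0"
    using that z by auto
  ultimately show ?thesis
    unfolding M_iff by blast
qed

lemma continuous_map_lift:
  assumes cont: "\<And>v. continuous_map X euclideanreal (\<lambda>p. x p v)" "continuous_map X euclideanreal s"
      "\<And>v. continuous_map X euclideanreal (\<lambda>p. b p v)" "continuous_map X euclideanreal z"
    and pos: "\<And>p v. p \<in> topspace X \<Longrightarrow> 0 \<le> x p v" "\<And>p. p \<in> topspace X \<Longrightarrow> 0 \<le> s p"
      "\<And>p v. p \<in> topspace X \<Longrightarrow> 0 \<le> b p v" "\<And>p. p \<in> topspace X \<Longrightarrow> 0 \<le> z p"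
    and supp: "\<And>p. p \<in> topspace X \<Longrightarrow> {v. x p v \<noteq> 0} \<in> K" "\<And>p. p \<in> topspace X \<Longrightarrow> {v. b p v \<noteq> 0} \<subseteq> V"
      "\<And>p. p \<in> topspace X \<Longrightarrow> z p = 0 \<or> s p = 0"
    and ne: "\<And>p. p \<in> topspace X \<Longrightarrow> z p + (\<Sum>v\<in>V. x p v) + s p = 1"
      "\<And>p. p \<in> topspace X \<Longrightarrow> 0 < s p \<Longrightarrow> \<exists>v. b p v \<noteq> 0"
  shows "continuous_map X (geometric_realization M)
      (\<lambda>p. normalise W (lift_levels (x p) (s p) (b p) (z p)))" (is ?C)
    and "p \<in> topspace X \<Longrightarrow> {w. normalise W (lift_levels (x p) (s p) (b p) (z p)) w \<noteq> 0} =
      {w. lift_levels (x p) (s p) (b p) (z p) w \<noteq> 0}" (is "_ \<Longrightarrow> ?S p")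
proof -
  have "\<exists>w. lift_levels (x p) (s p) (b p) (z p) w \<noteq> 0" if p: "p \<in> topspace X" for p
  proof -
    \<comment> \<open>Some weight always survives: the apex, or a lower copy of \<open>x\<close>
      while \<open>s p\<close> is below 1/2, or an upper copy of \<open>x\<close> at exactly 1/2,
      where the lower weights are gone and \<open>b\<close> is still off, or \<open>b\<close> beyond
      1/2.\<close>
    consider "z p \<noteq> 0" | "z p = 0" "2 * s p < 1" | "z p = 0" "2 * s p = 1" | "2 * s p > 1" by linarith
    then show ?thesis
    proof cases
      case 1
      then show ?thesis by (intro exI[of _ Apex]) simp
    next
      case 2
      then have "(\<Sum>v\<in>V. x p v) \<noteq> 0" using ne(1)[OF p] by linarith
      then obtain v where "x p v \<noteq> 0" by (meson sum.neutral)
      then show ?thesis using 2 by (intro exI[of _ "Lower v"]) (simp add: max_def)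
    next
      case 3
      then have "(\<Sum>v\<in>V. x p v) \<noteq> 0" using ne(1)[OF p] by linarith
      then obtain v where "x p v \<noteq> 0" by (meson sum.neutral)
      then show ?thesis using 3 by (intro exI[of _ "Upper v"]) auto
    next
      case 4
      then obtain v where "b p v \<noteq> 0" using ne(2)[OF p] by auto
      then have "0 < (2 * s p - 1) * b p v" "0 \<le> s p * x p v"
        using 4 pos[OF p] by (simp_all add: less_le)
      then show ?thesis using 4 by (intro exI[of _ "Upper v"]) (simp add: max_def)
    qed
  qed
  moreover have "continuous_map X euclideanreal (\<lambda>p. lift_levels (x p) (s p) (b p) (z p) w)" for w
    using cont by (cases w) (auto intro!: continuous_intros)
  moreover have "0 \<le> lift_levels (x p) (s p) (b p) (z p) w" if "p \<in> topspace X" for p w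
    using pos[OF that] by (cases w) auto
  ultimately show ?C "p \<in> topspace X \<Longrightarrow> ?S p"
    using continuous_map_normalise[OF finW, of X "\<lambda>p. lift_levels (x p) (s p) (b p) (z p)"]
      lift_levels_M[OF supp] by simp_all
qed

text \<open>A point \<open>p\<close> and \<open>lift (collapse p)\<close> may have no common
  carrier: \<open>Upper g\<close> can be adjacent to a lower vertex of \<open>p\<close>. The
  homotopy therefore runs through \<open>mid\<close>, which pushes \<open>p\<close> upwards using
  its own upper weights in place of \<open>g\<close>.\<close>

lemma realization_levelled_mycielskian:
  assumes "V \<noteq> {}"
  shows "geometric_realization M homotopy_equivalent_space geometric_realization L"
proof -
  obtain g where g: "g \<in> V" using assms by blast
  let ?M = "geometric_realization M" and ?L = "geometric_realization L"
  define lift where "lift q = normalise W (lift_levels (\<lambda>v. q (Equator v)) (q South_Pole) (indicator {g}) (q North_Pole))"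
    for q :: "'a suspension_vertex \<Rightarrow> real"
  define mid where "mid p = normalise W (lift_levels (\<lambda>v. p (Lower v)) (\<Sum>v\<in>V. p (Upper v)) (\<lambda>v. p (Upper v)) (p Apex))"
    for p :: "'a mycielskian_vertex \<Rightarrow> real"
  have coordM: "continuous_map ?M euclideanreal (\<lambda>p. p w)" for w
    using continuous_map_coordinate[OF continuous_map_id] by (simp add: id_def)
  have coordL: "continuous_map ?L euclideanreal (\<lambda>p. p w)" for w
    using continuous_map_coordinate[OF continuous_map_id] by (simp add: id_def)
  have ind: "{v. indicator {g} v \<noteq> (0::real)} = {g}"
    by (auto simp: indicator_def)
  have L_D: "0 \<le> q w" "{v. q (Equator v) \<noteq> 0} \<in> K" "q North_Pole = 0 \<or> q South_Pole = 0"
    "q North_Pole + (\<Sum>v\<in>V. q (Equator v)) + q South_Pole = 1"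
    if "q \<in> topspace ?L" for q w
    using that unfolding in_realization_suspension_complex[OF fin] by auto
  have lift: "continuous_map ?L ?M lift"
    unfolding lift_def
    by (rule continuous_map_lift(1)) (use g in \<open>auto simp: ind coordL L_D intro!: exI[of _ g]\<close>)
  have lift_supp: "{w. lift q w \<noteq> 0} =
      {w. lift_levels (\<lambda>v. q (Equator v)) (q South_Pole) (indicator {g}) (q North_Pole) w \<noteq> 0}"
    if "q \<in> topspace ?L" for q
    unfolding lift_def
    by (rule continuous_map_lift(2)[OF _ _ _ _ _ _ _ _ _ _ _ _ _ that])
      (use g in \<open>auto simp: ind coordL L_D intro!: exI[of _ g]\<close>)
  have sum_pos: "0 \<le> (\<Sum>v\<in>V. p (Upper v))" if "p \<in> topspace ?M" for p
    using realization_M_D(1)[OF that] by (simp add: sum_nonneg)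
  have poles: "p Apex = 0 \<or> (\<Sum>v\<in>V. p (Upper v)) = 0" if "p \<in> topspace ?M" for p
    using realization_M_D(5)[OF that] by (cases "p Apex = 0") auto
  have upper: "\<exists>v. p (Upper v) \<noteq> 0" if "0 < (\<Sum>v\<in>V. p (Upper v))" for p :: "'a mycielskian_vertex \<Rightarrow> real"
    using that by (metis less_irrefl sum.neutral)
  have mid: "continuous_map ?M ?M mid"
    unfolding mid_def
    by (rule continuous_map_lift(1))
      (auto simp: realization_M_D(1,2,6) sum_pos poles intro: coordM upper continuous_map_sum G(1)
        dest: realization_M_D(3))
  have mid_supp: "{w. mid p w \<noteq> 0} =
      {w. lift_levels (\<lambda>v. p (Lower v)) (\<Sum>v\<in>V. p (Upper v)) (\<lambda>v. p (Upper v)) (p Apex) w \<noteq> 0}"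
    if "p \<in> topspace ?M" for p
    unfolding mid_def
    by (rule continuous_map_lift(2)[OF _ _ _ _ _ _ _ _ _ _ _ _ _ that])
      (auto simp: realization_M_D(1,2,6) sum_pos poles intro: coordM upper continuous_map_sum G(1)
        dest: realization_M_D(3))
  have "homotopic_with (\<lambda>_. True) ?M ?M (lift \<circ> collapse) mid"
  proof (rule homotopic_contiguous)
    show "continuous_map ?M ?M (lift \<circ> collapse)"
      by (rule continuous_map_compose[OF continuous_map_collapse lift])
    fix p assume p: "p \<in> topspace ?M"
    define s where "s = (\<Sum>v\<in>V. p (Upper v))"
    let ?lift = "\<lambda>b. lift_levels (\<lambda>v. p (Lower v)) s b (p Apex)"
    have supp: "{w. (lift \<circ> collapse) p w \<noteq> 0} = {w. ?lift (indicator {g}) w \<noteq> 0}"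
      "{w. mid p w \<noteq> 0} = {w. ?lift (\<lambda>v. p (Upper v)) w \<noteq> 0}"
      using lift_supp[OF collapse_realization[OF p]] mid_supp[OF p] by (simp_all add: s_def)
    show "{w. (lift \<circ> collapse) p w \<noteq> 0} \<union> {w. mid p w \<noteq> 0} \<in> M"
    \<comment> \<open>Up to 1/2 the choice of \<open>b\<close> has no effect and the two maps agree.
      Beyond 1/2 both points lie on the upper level, where every set of vertices is a
      simplex.\<close>
    proof (cases "2 * s \<le> 1")
      case True
      then have "?lift b w = ?lift (\<lambda>v. p (Upper v)) w" for b w
        by (cases w) (simp_all add: max_def)
      then have "{w. (lift \<circ> collapse) p w \<noteq> 0} = {w. mid p w \<noteq> 0}"
        unfolding supp by (metis (lifting))
      moreover have "{w. mid p w \<noteq> 0} \<in> M"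
        unfolding supp using p poles[OF p] realization_M_D(2,3)[OF p] by (intro lift_levels_M) (auto simp: s_def)
      ultimately show ?thesis by simp
    next
      case False
      then have "p Apex = 0" using poles[OF p] by (auto simp: s_def)
      have "{v. p (Lower v) \<noteq> 0} \<subseteq> V"
        using realization_M_D(2)[OF p] by (auto simp: independence_complex_def)
      moreover have "Upper -` {w. ?lift b w \<noteq> 0} \<subseteq> {v. p (Lower v) \<noteq> 0} \<union> {v. b v \<noteq> 0}" for b
        by auto
      ultimately have "Upper -` {w. ?lift b w \<noteq> 0} \<subseteq> V" if "{v. b v \<noteq> 0} \<subseteq> V" for b
        using that by blast
      from this[of "indicator {g}"] this[of "\<lambda>v. p (Upper v)"]
      have "Upper -` ({w. ?lift (indicator {g}) w \<noteq> 0} \<union> {w. ?lift (\<lambda>v. p (Upper v)) w \<noteq> 0}) \<subseteq> V"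
        using g realization_M_D(3)[OF p] by (simp add: ind)
      moreover have "Lower v \<notin> {w. ?lift b w \<noteq> 0}" "Apex \<notin> {w. ?lift b w \<noteq> 0}" for v b
        using False \<open>p Apex = 0\<close> by (simp_all add: max_def)
      moreover have "{} \<in> K" by (simp add: independence_complex_def)
      ultimately show ?thesis
        unfolding supp M_iff by auto
    qed
  qed (rule mid)
  \<comment> \<open>Besides the vertices already in \<open>p\<close>, \<open>mid p\<close> uses only
    upper copies of lower vertices of \<open>p\<close>. The lower part is independent in
    \<open>G\<close>, so these copies are not adjacent to it.\<close>
  moreover have "homotopic_with (\<lambda>_. True) ?M ?M mid id"
  proof (rule homotopic_contiguous)
    fix p assume p: "p \<in> topspace ?M"
    note pD = realization_M_D[OF p]
    let ?S = "{w. mid p w \<noteq> 0} \<union> {w. id p w \<noteq> 0}"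
    have L: "Lower -` ?S = {v. p (Lower v) \<noteq> 0}"
      unfolding mid_supp[OF p] by auto
    have U: "Upper -` ?S \<subseteq> {v. p (Lower v) \<noteq> 0 \<or> p (Upper v) \<noteq> 0}"
      unfolding mid_supp[OF p] by auto
    have "(a, b) \<notin> E" if "p (Lower a) \<noteq> 0" "p (Lower b) \<noteq> 0 \<or> p (Upper b) \<noteq> 0" for a b
      using that pD(2,4) by (auto simp: independence_complex_def)
    moreover have "{v. p (Lower v) \<noteq> 0 \<or> p (Upper v) \<noteq> 0} \<subseteq> V"
      using pD(2,3) by (auto simp: independence_complex_def)
    moreover have "Upper -` ?S = {}" if "Apex \<in> ?S"
    proof -
      have "p Apex \<noteq> 0" using that unfolding mid_supp[OF p] by auto
      then show ?thesis
        using pD(5) unfolding mid_supp[OF p] by auto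
    qed
    ultimately show "?S \<in> M"
      unfolding M_iff L using pD(2) L U by blast
  qed (use mid in auto)
  ultimately have "homotopic_with (\<lambda>_. True) ?M ?M (lift \<circ> collapse) id"
    by (rule homotopic_with_trans)
  moreover have "homotopic_with (\<lambda>_. True) ?L ?L (collapse \<circ> lift) id"
  proof (rule homotopic_contiguous)
    show "continuous_map ?L ?L (collapse \<circ> lift)"
      by (rule continuous_map_compose[OF lift continuous_map_collapse])
    fix q assume q: "q \<in> topspace ?L"
    have supp: "lift q w \<noteq> 0 \<longleftrightarrow>
        lift_levels (\<lambda>v. q (Equator v)) (q South_Pole) (indicator {g}) (q North_Pole) w \<noteq> 0" for w
      using lift_supp[OF q] by blast
    \<comment> \<open>The composite never enlarges the support. In particular, with
      \<open>q South_Pole = 0\<close> both summands of each upper weight vanish.\<close>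
    have "q w \<noteq> 0" if "collapse (lift q) w \<noteq> 0" for w
    proof (cases w)
      case South_Pole
      then obtain v where "lift q (Upper v) \<noteq> 0"
        using \<open>collapse (lift q) w \<noteq> 0\<close> by (auto elim: sum.not_neutral_contains_not_neutral)
      then show ?thesis unfolding supp South_Pole by auto
    qed (use that in \<open>auto simp: supp\<close>)
    then have "{w. (collapse \<circ> lift) q w \<noteq> 0} \<union> {w. id q w \<noteq> 0} = {w. q w \<noteq> 0}" by auto
    then show "{w. (collapse \<circ> lift) q w \<noteq> 0} \<union> {w. id q w \<noteq> 0} \<in> L"
      using q by (simp add: topspace_geometric_realization)
  qed simp
  ultimately show ?thesis
    unfolding homotopy_equivalent_space_def using continuous_map_collapse lift by blast
qed

end

section \<open>Assembly, including graphs with isolated vertices\<close>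

theorem theorem4p1:
  fixes G :: "'a pair_pre_digraph"
  assumes "pair_pseudo_graph G"
    and "pverts G \<noteq> {}"
  shows "geometric_realization (independence_complex (mycielskian G))
           homotopy_equivalent_space
         suspension (geometric_realization (independence_complex G))"
proof -
  note G = pair_pseudo_graphD[OF assms(1)]
  let ?K = "independence_complex G" and ?M = "independence_complex (levelled_mycielskian G)"
  have "geometric_realization ?M homotopy_equivalent_space
      geometric_realization (suspension_complex ?K)"
  proof (cases "\<forall>u\<in>pverts G. \<exists>v. (u, v) \<in> parcs G")
    case True
    then interpret graph_without_isolated_vertices G
      using assms(1) by (intro graph_without_isolated_vertices.intro) auto
    show ?thesis by (rule realization_levelled_mycielskian[OF assms(2)])
  next
    case False
    \<comment> \<open>Here \<open>g\<close> has no neighbour, not even itself. It can join every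
      independent set of \<open>G\<close>, and its lower copy and its equatorial copy can likewise
      join every simplex, so both complexes are cones.\<close>
    then obtain g where g: "g \<in> pverts G" "\<And>v. (g, v) \<notin> parcs G" "\<And>v. (v, g) \<notin> parcs G"
      using G(3) by (meson symD)
    then have K: "insert g S \<in> ?K" if "S \<in> ?K" for S
      using that by (auto simp: independence_complex_def)
    have M: "insert (Lower g) S \<in> ?M" if "S \<in> ?M" for S
    proof -
      have "Lower -` insert (Lower g) S = insert g (Lower -` S)" "Upper -` insert (Lower g) S = Upper -` S"
        by auto
      then show ?thesis
        using that K g unfolding independence_complex_levels[OF G(3)] by auto
    qed
    have L: "insert (Equator g) S \<in> suspension_complex ?K" if "S \<in> suspension_complex ?K" for S
    proof -
      have "Equator -` insert (Equator g) S = insert g (Equator -` S)" by auto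
      then show ?thesis
        using that K by (auto simp: suspension_complex_def)
    qed
    have "{} \<in> ?M" "{} \<in> suspension_complex ?K"
      by (auto simp: independence_complex_def suspension_complex_def)
    with M L show ?thesis
      by (intro cones_homotopy_equivalent)
  qed
  moreover have "suspension (geometric_realization ?K) homeomorphic_space
      geometric_realization (suspension_complex ?K)"
    by (rule suspension_realization[OF G(1) Union_independence_complex])
      (auto simp: independence_complex_def)
  ultimately show ?thesis
    using realization_mycielskian_levels[OF G(2) assms(2)]
    by (meson homeomorphic_imp_homotopy_equivalent_space homotopy_equivalent_space_sym homotopy_eqv_trans)
qed

end
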